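(* Suppose there exists $x^*\in\mathbb{R}^p$ with $F(x^* )=0$, and suppose $$F(\mathbb{R}^p)\cap\mathrm{Ker}\big(\mathbb{E}_{\mathbf{S}\sim\mathcal{D}_y}[\mathbf{H}_{\mathbf{S}}(y)]\big)=\{0\}\qquad\text{for all }y\in\mathbb{R}^p.$$ Then, for every $y\in\mathbb{R}^p$, $$\operatorname*{argmin}_{x\in\mathbb{R}^p}f_y(x)=\{x\in\mathbb{R}^p\mid F(x)=0\}.$$
   Context: $F:\mathbb{R}^p\to\mathbb{R}^m$ is continuously differentiable, $DF(x)=[\nabla F_1(x)\ \cdots\ \nabla F_m(x)]\in\mathbb{R}^{p\times m}$ is the transpose of its Jacobian, and $F(\mathbb{R}^p)$ is its range. For each $y\in\mathbb{R}^p$, $\mathcal{D}_y$ is a probability distribution over sketching matrices $\mathbf{S}\in\mathbb{R}^{m\times\tau}$, $\dagger$ is the Moore-Penrose pseudoinverse, $\mathbf{H}_{\mathbf{S}}(y)=\mathbf{S}\big(\mathbf{S}^\top DF(y)^\top DF(y)\mathbf{S}\big)^\dagger\mathbf{S}^\top\in\mathbb{R}^{m\times m}$, and $$f_y(x)=\tfrac12F(x)^\top\,\mathbb{E}_{\mathbf{S}\sim\mathcal{D}_y}[\mathbf{H}_{\mathbf{S}}(y)]\,F(x),$$ the expectation being understood to be finite. $\mathrm{Ker}$ denotes the null space. *)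

theory Defs
  imports "HOL-Analysis.Analysis" "HOL-Probability.Probability"
begin

text \<open>
  A real \<open>r \<times> c\<close> matrix has type \<^typ>\<open>real^'c^'r\<close>, the column index coming first. Throughout,
  \<open>'p\<close>, \<open>'m\<close> and \<open>'t\<close> are the index types of the dimensions \<open>p\<close>, \<open>m\<close> and \<open>\<tau>\<close>.
\<close>

definition continuously_differentiable :: "(real^'p \<Rightarrow> real^'m) \<Rightarrow> bool" where
  "continuously_differentiable F \<longleftrightarrow>
     (\<forall>x. F differentiable (at x)) \<and> continuous_on UNIV (\<lambda>x. jacobian F (at x))"

text \<open>The transposed Jacobian, whose columns are the gradients of the components of \<open>F\<close>.\<close>

definition DF :: "(real^'p \<Rightarrow> real^'m) \<Rightarrow> real^'p \<Rightarrow> real^'m^'p" where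
  "DF F x = transpose (jacobian F (at x))"

text \<open>
  The Moore--Penrose pseudoinverse: the unique matrix satisfying the four Penrose equations.
\<close>

definition is_pinv :: "real^'n^'k \<Rightarrow> real^'k^'n \<Rightarrow> bool" where
  "is_pinv A X \<longleftrightarrow>
     A ** X ** A = A \<and>
     X ** A ** X = X \<and>
     transpose (A ** X) = A ** X \<and>
     transpose (X ** A) = X ** A"

definition pinv :: "real^'n^'k \<Rightarrow> real^'k^'n" where
  "pinv A = (THE X. is_pinv A X)"

definition Ker :: "real^'n^'k \<Rightarrow> (real^'n) set" where
  "Ker A = {v. A *v v = 0}"

definition H :: "(real^'p \<Rightarrow> real^'m) \<Rightarrow> real^'p \<Rightarrow> real^'t^'m \<Rightarrow> real^'m^'m" where
  "H F y S =
     S ** pinv (transpose S ** transpose (DF F y) ** DF F y ** S) ** transpose S"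

definition EH ::
  "(real^'p \<Rightarrow> real^'m) \<Rightarrow> (real^'p \<Rightarrow> (real^'t^'m) measure) \<Rightarrow> real^'p \<Rightarrow> real^'m^'m" where
  "EH F \<D> y = (\<integral>S. H F y S \<partial>(\<D> y))"

definition sketched_objective ::
  "(real^'p \<Rightarrow> real^'m) \<Rightarrow> (real^'p \<Rightarrow> (real^'t^'m) measure) \<Rightarrow> real^'p \<Rightarrow> real^'p \<Rightarrow> real" where
  "sketched_objective F \<D> y x = 1 / 2 * (F x \<bullet> (EH F \<D> y *v F x))"

definition argmin :: "('a \<Rightarrow> real) \<Rightarrow> 'a set" where
  "argmin f = {x. is_arg_min f (\<lambda>_. True) x}"

end

theory Submission
  imports Defs
begin

text \<open>
  The pseudoinverse \<open>X\<close> of a symmetric positive semidefinite matrix \<open>A\<close> is again one, because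
  \<open>X = X A X\<close> and \<open>X\<close> is symmetric by uniqueness. Hence every \<open>H F y S\<close>, and with it the
  expectation \<open>EH F \<D> y\<close>, is symmetric positive semidefinite. The quadratic form of such a matrix
  vanishes only on its kernel, so \<open>f\<^sub>y\<close> is nonnegative and vanishes exactly where \<open>F x\<close> lies in that
  kernel, i.e. where \<open>F x = 0\<close>.
\<close>

section \<open>Pseudoinverse of a symmetric matrix\<close>

text \<open>\<open>A ** X\<close> and \<open>A ** Y\<close> are symmetric and each absorbs the
  other, so transposing a product of the two identifies them; likewise \<open>X ** A\<close> and
  \<open>Y ** A\<close>. Then X = XAX = YAX = YAY = Y.\<close>

lemma is_pinv_unique:
  fixes A :: "real^'n^'k"
  assumes X: "is_pinv A X" and Y: "is_pinv A Y"
  shows "X = Y"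
proof -
  have "A ** X = transpose (A ** Y ** A ** X)"
    using X Y by (simp add: is_pinv_def)
  also have "\<dots> = transpose (A ** X) ** transpose (A ** Y)"
    by (metis matrix_mul_assoc matrix_transpose_mul)
  also have "\<dots> = A ** X ** A ** Y"
    using X Y by (simp add: is_pinv_def matrix_mul_assoc)
  also have "\<dots> = A ** Y"
    using X by (simp add: is_pinv_def)
  finally have AX: "A ** X = A ** Y" .
  have "X ** A = transpose (X ** (A ** Y ** A))"
    using X Y by (simp add: is_pinv_def)
  also have "\<dots> = transpose (Y ** A) ** transpose (X ** A)"
    by (metis matrix_mul_assoc matrix_transpose_mul)
  also have "\<dots> = Y ** A ** X ** A"
    using X Y by (simp add: is_pinv_def matrix_mul_assoc)
  also have "\<dots> = Y ** A"
    using X by (metis is_pinv_def matrix_mul_assoc)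
  finally have XA: "X ** A = Y ** A" .
  have "X = X ** A ** X"
    using X by (simp add: is_pinv_def)
  also have "\<dots> = Y ** A ** Y"
    by (metis AX XA matrix_mul_assoc)
  also have "\<dots> = Y"
    using Y by (simp add: is_pinv_def)
  finally show ?thesis .
qed

text \<open>Transposition preserves each of the first two Penrose equations and swaps the last
  two.\<close>

lemma is_pinv_transpose:
  fixes A :: "real^'n^'k"
  assumes "is_pinv A X"
  shows "is_pinv (transpose A) (transpose X)"
  using assms unfolding is_pinv_def
  by (metis matrix_mul_assoc matrix_transpose_mul)

lemma transpose_eq_if_inner_symmetric:
  fixes A :: "real^'n^'n"
  assumes "\<And>v w. v \<bullet> (A *v w) = w \<bullet> (A *v v)"
  shows "transpose A = A"
proof -
  have "transpose A *v w = A *v w" for w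
    by (rule vector_eq_ldot[THEN iffD1])
      (metis assms dot_lmul_matrix inner_commute transpose_matrix_vector)
  then show ?thesis
    by (simp add: matrix_eq)
qed

lemma orthogonal_projection_matrix:
  fixes S :: "(real^'n) set"
  assumes "subspace S"
  obtains P :: "real^'n^'n" where
    "transpose P = P" "\<And>v. P *v v \<in> S" "\<And>v. v \<in> S \<Longrightarrow> P *v v = v"
proof -
  obtain B where B: "B \<subseteq> S" "pairwise orthogonal B" "\<And>x. x \<in> B \<Longrightarrow> norm x = 1"
    "independent B" "span B = S"
    using orthonormal_basis_subspace[OF assms] by metis
  have fin: "finite B"
    using B(4) independent_imp_finite by blast
  \<comment> \<open>Fourier expansion in the orthonormal basis \<open>B\<close>. For v in
    \<open>S\<close> the residual v - p v lies in the span of \<open>B\<close> and is orthogonal to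
    all of \<open>B\<close>, hence to itself.\<close>
  define p where "p = (\<lambda>v::real^'n. \<Sum>b\<in>B. (b \<bullet> v) *\<^sub>R b)"
  have "linear p"
    unfolding p_def
    by (rule linearI)
      (simp_all add: inner_add_right scaleR_left_distrib sum.distrib scaleR_sum_right)
  then have mp: "matrix p *v v = p v" for v
    by (simp add: matrix_works)
  have pS: "p v \<in> S" for v
    unfolding p_def using B(1) assms
    by (intro subspace_sum subspace_scale) auto
  have sym: "v \<bullet> p w = w \<bullet> p v" for v w
    unfolding p_def inner_sum_right
    by (rule sum.cong) (simp_all add: inner_commute)
  have bp: "b \<bullet> p v = b \<bullet> v" if b: "b \<in> B" for b v
  proof -
    have "b \<bullet> p v = (\<Sum>c\<in>B. if c = b then b \<bullet> v else 0)"
      unfolding p_def inner_sum_right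
    proof (rule sum.cong)
      fix c assume "c \<in> B"
      then show "b \<bullet> ((c \<bullet> v) *\<^sub>R c) = (if c = b then b \<bullet> v else 0)"
        using B(2,3) b by (auto simp: pairwise_def orthogonal_def norm_eq_1)
    qed simp
    then show ?thesis
      using b fin by simp
  qed
  have "p v = v" if "v \<in> S" for v
  proof -
    have "v - p v \<in> span B"
      using that pS B(5) assms by (simp add: subspace_diff)
    moreover have "orthogonal (v - p v) b" if "b \<in> B" for b
      using bp[OF that, of v] by (simp add: orthogonal_def inner_diff_right inner_commute)
    ultimately have "orthogonal (v - p v) (v - p v)"
      by (meson orthogonal_to_span)
    then show ?thesis
      by (simp add: orthogonal_def)
  qed
  then show thesis
    using that[of "matrix p"] pS sym
    by (simp add: mp transpose_eq_if_inner_symmetric)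
qed

text \<open>
  With \<open>P\<close> the orthogonal projection onto the kernel of \<open>A\<close>, the matrix \<open>A + P\<close> is invertible and
  the pseudoinverse is \<open>(A + P)\<^sup>-\<^sup>1 - P\<close>.
\<close>

lemma is_pinv_symmetric_exists:
  fixes A :: "real^'n^'n"
  assumes A: "transpose A = A"
  shows "\<exists>X. is_pinv A X"
proof -
  have "subspace (Ker A)"
    by (auto simp: Ker_def subspace_def matrix_vector_right_distrib matrix_vector_mult_scaleR)
  then obtain P :: "real^'n^'n" where P: "transpose P = P" "\<And>v. P *v v \<in> Ker A"
    "\<And>v. v \<in> Ker A \<Longrightarrow> P *v v = v"
    using orthogonal_projection_matrix by blast
  have AP: "A ** P = 0"
    using P(2) by (simp add: matrix_eq Ker_def flip: matrix_vector_mul_assoc)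
  have PA: "P ** A = 0"
    using arg_cong[OF AP, of transpose] A P(1)
    by (simp add: matrix_transpose_mul) (simp add: transpose_def vec_eq_iff)
  have PP: "P ** P = P"
    using P(2,3) by (simp add: matrix_eq flip: matrix_vector_mul_assoc)
  \<comment> \<open>Multiplying by \<open>P\<close> removes the \<open>A\<close> part and leaves P v
    = 0. So A v = 0 as well, and \<open>P\<close> fixes v.\<close>
  have "v = 0" if v: "(A + P) *v v = 0" for v
  proof -
    have "P *v v = P *v ((A + P) *v v)"
      by (simp add: matrix_vector_mul_assoc matrix_add_ldistrib PA PP)
    then have "P *v v = 0"
      using v by simp
    moreover from this have "v \<in> Ker A"
      using v by (simp add: Ker_def matrix_vector_mult_add_rdistrib)
    ultimately show "v = 0"
      using P(3) by simp
  qed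
  then obtain C where CB: "C ** (A + P) = mat 1"
    using matrix_left_invertible_ker by blast
  then have BC: "(A + P) ** C = mat 1"
    using matrix_left_right_inverse by blast
  have add_r: "(N + K) ** M = N ** M + K ** M" for M N K :: "real^'n^'n"
    by (simp add: matrix_eq matrix_vector_mult_add_rdistrib flip: matrix_vector_mul_assoc)
  have "C ** P = C ** (A + P) ** P"
    by (simp add: add_r AP PP flip: matrix_mul_assoc)
  then have CP: "C ** P = P"
    by (simp add: CB)
  have "P ** C = P ** ((A + P) ** C)"
    by (simp add: matrix_mul_assoc matrix_add_ldistrib PA PP)
  then have PC: "P ** C = P"
    by (simp add: BC)
  have AC: "A ** C = mat 1 - P"
    using BC by (simp add: add_r PC eq_diff_eq)
  have CA: "C ** A = mat 1 - P"
    using CB by (simp add: matrix_add_ldistrib CP eq_diff_eq)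
  have sub_l: "M ** (N - K) = M ** N - M ** K" for M N K :: "real^'n^'n"
    by (simp add: matrix_eq matrix_vector_mult_diff_distrib matrix_vector_mult_diff_rdistrib
        flip: matrix_vector_mul_assoc)
  have sub_r: "(N - K) ** M = N ** M - K ** M" for M N K :: "real^'n^'n"
    by (simp add: matrix_eq matrix_vector_mult_diff_rdistrib flip: matrix_vector_mul_assoc)
  have "transpose (mat 1 - P) = mat 1 - P"
    using P(1) by (simp add: transpose_def mat_def vec_eq_iff)
  \<comment> \<open>\<open>C\<close> alone satisfies every Penrose equation except possibly the
    second, since CAC = C - P. Subtracting \<open>P\<close> repairs that one and leaves AC and CA
    unchanged.\<close>
  then have "is_pinv A (C - P)"
    unfolding is_pinv_def by (simp add: sub_l sub_r AC CA AP PA PP PC)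
  then show ?thesis ..
qed

lemma is_pinv_pinv:
  fixes A :: "real^'n^'n"
  assumes "transpose A = A"
  shows "is_pinv A (pinv A)"
  unfolding pinv_def
  by (rule theI') (use is_pinv_symmetric_exists[OF assms] is_pinv_unique in blast)

lemma transpose_pinv:
  fixes A :: "real^'n^'n"
  assumes "transpose A = A"
  shows "transpose (pinv A) = pinv A"
  using is_pinv_transpose[OF is_pinv_pinv[OF assms]] is_pinv_pinv[OF assms]
  by (simp add: assms is_pinv_unique)

section \<open>Positive semidefinite matrices\<close>

text \<open>Over the reals symmetry must be demanded separately: a quarter turn of the plane has
  zero quadratic form but trivial kernel.\<close>

definition psd :: "real^'n^'n \<Rightarrow> bool" where
  "psd A \<longleftrightarrow> transpose A = A \<and> (\<forall>v. 0 \<le> v \<bullet> (A *v v))"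

lemma inner_transpose_matrix_vector:
  fixes M :: "real^'n^'k"
  shows "v \<bullet> (transpose M *v w) = (M *v v) \<bullet> w"
  by (metis dot_lmul_matrix inner_commute transpose_matrix_vector transpose_transpose)

lemma psd_inner_commute:
  assumes "psd A"
  shows "v \<bullet> (A *v w) = w \<bullet> (A *v v)"
  using assms by (metis inner_commute inner_transpose_matrix_vector psd_def)

lemma psd_gram: "psd (transpose M ** M)"
  by (simp add: psd_def matrix_transpose_mul inner_transpose_matrix_vector
      del: transpose_matrix_vector flip: matrix_vector_mul_assoc)

lemma psd_congruence:
  fixes S :: "real^'n^'k"
  assumes "psd A"
  shows "psd (S ** A ** transpose S)"
proof -
  have "v \<bullet> (S ** A ** transpose S *v v) = (transpose S *v v) \<bullet> (A *v (transpose S *v v))" for v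
    using inner_transpose_matrix_vector[of v "transpose S"]
    by (simp flip: matrix_vector_mul_assoc)
  then show ?thesis
    using assms by (simp add: psd_def matrix_transpose_mul matrix_mul_assoc)
qed

lemma psd_pinv:
  assumes "psd A"
  shows "psd (pinv A)"
proof -
  have A: "transpose A = A"
    using assms by (simp add: psd_def)
  have "pinv A ** A ** transpose (pinv A) = pinv A"
    using is_pinv_pinv[OF A] by (simp add: transpose_pinv[OF A] is_pinv_def)
  then show ?thesis
    using psd_congruence[OF assms, of "pinv A"] by simp
qed

lemma psd_H: "psd (H F y S)"
proof -
  \<comment> \<open>Regrouped, the matrix under the pseudoinverse is the Gram matrix of
    \<open>DF F y ** S\<close>.\<close>
  have "transpose S ** transpose (DF F y) ** DF F y ** S
      = transpose (DF F y ** S) ** (DF F y ** S)"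
    by (simp add: matrix_transpose_mul matrix_mul_assoc)
  then show ?thesis
    unfolding H_def by (metis psd_congruence psd_gram psd_pinv)
qed

text \<open>For fixed v and w the map from A to v \<bullet> (A w) is bounded linear, so it commutes
  with the integral. Symmetry and nonnegativity then pass from the integrand.\<close>

lemma psd_integral:
  fixes f :: "'a \<Rightarrow> real^'n^'n"
  assumes f: "integrable M f" and psd: "\<And>x. psd (f x)"
  shows "psd (\<integral>x. f x \<partial>M)"
proof -
  have form: "v \<bullet> ((\<integral>x. f x \<partial>M) *v w) = (\<integral>x. v \<bullet> (f x *v w) \<partial>M)" for v w
  proof -
    have "bounded_linear (\<lambda>A::real^'n^'n. v \<bullet> (A *v w))"
      unfolding linear_conv_bounded_linear[symmetric]
      by (rule linearI)
        (simp_all add: matrix_vector_mult_add_rdistrib inner_add_right scaleR_matrix_vector_assoc[symmetric])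
    from integral_bounded_linear[OF this f] show ?thesis
      by simp
  qed
  have "transpose (\<integral>x. f x \<partial>M) = (\<integral>x. f x \<partial>M)"
    by (rule transpose_eq_if_inner_symmetric)
      (simp add: form psd_inner_commute[OF psd, of w v for v w])
  moreover have "0 \<le> v \<bullet> ((\<integral>x. f x \<partial>M) *v v)" for v
    using psd by (simp add: form psd_def)
  ultimately show ?thesis
    by (simp add: psd_def)
qed

lemma psd_inner_eq_0_iff:
  assumes A: "psd A"
  shows "v \<bullet> (A *v v) = 0 \<longleftrightarrow> A *v v = 0"
proof
  assume v: "v \<bullet> (A *v v) = 0"
  define w where "w = A *v v"
  define c where "c = w \<bullet> (A *v w)"
  have c: "0 \<le> c"
    using A by (simp add: c_def psd_def)
  \<comment> \<open>The form at v + t w is 2 t (w \<bullet> w) + t^2 c, which a small negative t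
    makes negative unless w = 0. The denominator c + 1 stays positive even when c = 0.\<close>
  define t where "t = - (w \<bullet> w) / (c + 1)"
  have vw: "v \<bullet> (A *v w) = w \<bullet> w"
    using psd_inner_commute[OF A, of v w] by (simp add: w_def)
  have ww: "w \<bullet> w = - (t * (c + 1))"
    using c by (simp add: t_def)
  have "0 \<le> (v + t *\<^sub>R w) \<bullet> (A *v (v + t *\<^sub>R w))"
    using A by (simp add: psd_def)
  also have "\<dots> = 2 * t * (w \<bullet> w) + t\<^sup>2 * c"
    using v vw
    by (simp add: matrix_vector_right_distrib matrix_vector_mult_scaleR inner_add_left
        inner_add_right power2_eq_square distrib_left flip: w_def c_def)
  also have "\<dots> = - (t\<^sup>2 * (c + 2))"
    unfolding ww by (simp add: power2_eq_square algebra_simps)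
  finally have "t\<^sup>2 * (c + 2) \<le> 0"
    by simp
  then have "t = 0"
    using c by (simp add: mult_le_0_iff)
  then show "A *v v = 0"
    using ww by (simp add: w_def)
qed simp

theorem lemma3p1:
  fixes F :: "real^'p \<Rightarrow> real^'m"
    and \<D> :: "real^'p \<Rightarrow> (real^'t^'m) measure"
  assumes "continuously_differentiable F"
    and "\<And>y. prob_space (\<D> y)"
    and "\<And>y. sets (\<D> y) = sets borel"
    and "\<And>y. integrable (\<D> y) (H F y)"
    and "\<exists>x. F x = 0"
    and "\<And>y. range F \<inter> Ker (EH F \<D> y) = {0}"
  shows "\<forall>y. argmin (sketched_objective F \<D> y) = {x. F x = 0}"
proof
  fix y
  let ?f = "sketched_objective F \<D> y"
  have psd: "psd (EH F \<D> y)"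
    unfolding EH_def using assms(4) psd_H by (rule psd_integral)
  have nonneg: "0 \<le> ?f x" for x
    using psd by (simp add: sketched_objective_def psd_def)
  have zero: "?f x = 0 \<longleftrightarrow> F x = 0" for x
  proof -
    have "?f x = 0 \<longleftrightarrow> F x \<in> range F \<inter> Ker (EH F \<D> y)"
      by (simp add: sketched_objective_def psd_inner_eq_0_iff[OF psd] Ker_def)
    then show ?thesis
      by (simp add: assms(6))
  qed
  obtain z where "F z = 0"
    using assms(5) ..
  then have "?f z = 0"
    by (simp add: zero)
  \<comment> \<open>The root z shows that the lower bound 0 is attained, so the minimizers are
    exactly the points of value 0.\<close>
  then have "x \<in> argmin ?f \<longleftrightarrow> ?f x = 0" for x
    unfolding argmin_def is_arg_min_def mem_Collect_eq
    by (metis nonneg not_le order_antisym_conv)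
  then show "argmin ?f = {x. F x = 0}"
    by (auto simp: zero)
qed

end
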